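(* Consider the nonlinear three-parameter eigenvalue problem $T_i(\lambda,\mu,\nu)\,x_i=0$, $i=1,2,3$, where each $T_i(\lambda,\mu,\nu)$ is an $n_i\times n_i$ complex matrix depending (complex) differentiably on $(\lambda,\mu,\nu)$. Let $(\lambda_1,\mu_1,\nu_1)$ be an eigenvalue with left eigenvector $y_1\otimes y_2\otimes y_3$ and let $(\lambda_2,\mu_2,\nu_2)$ be an eigenvalue with right eigenvector $x_1\otimes x_2\otimes x_3$. Consider the quantity $$q=(y_1\otimes y_2\otimes y_3)^*\,T[(\lambda_1,\mu_1,\nu_1),(\lambda_2,\mu_2,\nu_2)]\,(x_1\otimes x_2\otimes x_3).$$ Then: (1) $q\ne0$ when $(\lambda_2,\mu_2,\nu_2)=(\lambda_1,\mu_1,\nu_1)$ is a simple eigenvalue (with right eigenvector $x_1\otimes x_2\otimes x_3$ and left eigenvector $y_1\otimes y_2\otimes y_3$); (2) $q=0$ when $(\lambda_2,\mu_2,\nu_2)\ne(\lambda_1,\mu_1,\nu_1)$, i.e. when $x_1\otimes x_2\otimes x_3$ and $y_1\otimes y_2\otimes y_3$ belong to different eigenvalues.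
   Context: The matrix functions $T_1,T_2,T_3$ are analytic on a product domain $\Omega_1\times\Omega_2\times\Omega_3\subseteq\mathbb{C}^3$ containing all points considered. A triple $(\lambda,\mu,\nu)$ is an eigenvalue with right eigenvector $x_1\otimes x_2\otimes x_3$ if $T_i(\lambda,\mu,\nu)x_i=0$ with $x_i\ne0$ for $i=1,2,3$; $y_1\otimes y_2\otimes y_3$ is a corresponding left eigenvector if $y_i^*T_i(\lambda,\mu,\nu)=0$ with $y_i\ne0$ for $i=1,2,3$. An eigenvalue is simple if it is a simple common zero of the system $\det T_i(\lambda,\mu,\nu)=0$, $i=1,2,3$, i.e. the $3\times3$ Jacobian matrix of $(\det T_1,\det T_2,\det T_3)$ with respect to $(\lambda,\mu,\nu)$ is nonsingular there. Divided difference: for $i=1,2,3$ put $$M_{i1}=\lim_{\lambda\to\lambda_2}\frac{T_i(\lambda,\mu_1,\nu_1)-T_i(\lambda_1,\mu_1,\nu_1)}{\lambda-\lambda_1},\quad M_{i2}=\lim_{\mu\to\mu_2}\frac{T_i(\lambda_2,\mu,\nu_1)-T_i(\lambda_2,\mu_1,\nu_1)}{\mu-\mu_1},$$ $$M_{i3}=\lim_{\nu\to\nu_2}\frac{T_i(\lambda_2,\mu_2,\nu)-T_i(\lambda_2,\mu_2,\nu_1)}{\nu-\nu_1}$$ (so that a partial derivative is obtained in a coordinate in which the two triples agree). Then $T[(\lambda_1,\mu_1,\nu_1),(\lambda_2,\mu_2,\nu_2)]$ is the operator determinant $$\left|\begin{array}{ccc} M_{11} & M_{12} & M_{13} \\ M_{21}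 & M_{22} & M_{23} \\ M_{31} & M_{32} & M_{33} \end{array}\right|_\otimes=\sum_{\sigma\in S_3}\mathrm{sgn}(\sigma)\,M_{1\sigma(1)}\otimes M_{2\sigma(2)}\otimes M_{3\sigma(3)},$$ where $\otimes$ is the Kronecker product. *)

theory Defs
  imports "HOL-Analysis.Analysis"
begin

type_synonym triple = "complex \<times> complex \<times> complex"

(* Multiplication of a matrix by a complex scalar; the library only has *s on vectors
   and the real scalar multiplication *\<^sub>R. *)
definition mscale :: "complex \<Rightarrow> complex^'n^'m \<Rightarrow> complex^'n^'m"  (infixr "*\<^sub>M" 75)
  where "c *\<^sub>M A = map_matrix (\<lambda>a. c * a) A"

(* Complex Frechet differentiability at every point of S, the derivative being the
   complex linear map given by the three partial derivatives D1, D2, D3.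
   For open S this is analyticity in three variables. *)
definition analytic3_on :: "(triple \<Rightarrow> complex^'n^'m) \<Rightarrow> triple set \<Rightarrow> bool"
  where "analytic3_on T S \<longleftrightarrow>
    (\<forall>p\<in>S. \<exists>D1 D2 D3.
       (T has_derivative (\<lambda>(h, k, l). h *\<^sub>M D1 + k *\<^sub>M D2 + l *\<^sub>M D3)) (at p))"

definition vconj :: "complex^'n \<Rightarrow> complex^'n"
  where "vconj y = (\<chi> i. cnj (y $ i))"

(* y^* A x *)
definition sesq :: "complex^'m \<Rightarrow> complex^'n^'m \<Rightarrow> complex^'n \<Rightarrow> complex"
  where "sesq y A x = (\<Sum>i\<in>UNIV. vconj y $ i * (A *v x) $ i)"

(* Kronecker products, with rows and columns indexed by pairs instead of by
   a linear enumeration of the pairs. *)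
definition vkron :: "complex^'a \<Rightarrow> complex^'b \<Rightarrow> complex^('a \<times> 'b)"  (infixr "\<otimes>\<^sub>v" 70)
  where "x \<otimes>\<^sub>v y = (\<chi> i. x $ fst i * y $ snd i)"

definition mkron ::
  "complex^'a^'c \<Rightarrow> complex^'b^'d \<Rightarrow> complex^('a \<times> 'b)^('c \<times> 'd)"  (infixr "\<otimes>\<^sub>M" 70)
  where "A \<otimes>\<^sub>M B = (\<chi> i j. A $ fst i $ fst j * B $ snd i $ snd j)"

(* The arguments are the three rows of the array of matrices; the matrices in different
   rows may differ in size. *)
definition operator_det3 ::
  "(complex^'a^'a)^3 \<Rightarrow> (complex^'b^'b)^3 \<Rightarrow> (complex^'c^'c)^3 \<Rightarrow>
   complex^('a \<times> 'b \<times> 'c)^('a \<times> 'b \<times> 'c)"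
  where "operator_det3 M1 M2 M3 =
    (\<Sum>\<sigma> | \<sigma> permutes (UNIV :: 3 set).
       of_int (sign \<sigma>) *\<^sub>M (M1 $ \<sigma> 1 \<otimes>\<^sub>M M2 $ \<sigma> 2 \<otimes>\<^sub>M M3 $ \<sigma> 3))"

(* The row (M_i1, M_i2, M_i3) of partial divided differences of T = T_i. *)
fun diff_row :: "(triple \<Rightarrow> complex^'n^'n) \<Rightarrow> triple \<Rightarrow> triple \<Rightarrow> (complex^'n^'n)^3"
  where "diff_row T (l1, m1, n1) (l2, m2, n2) = vector
    [Lim (at l2) (\<lambda>l. (1 / (l - l1)) *\<^sub>M (T (l, m1, n1) - T (l1, m1, n1))),
     Lim (at m2) (\<lambda>m. (1 / (m - m1)) *\<^sub>M (T (l2, m, n1) - T (l2, m1, n1))),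
     Lim (at n2) (\<lambda>n. (1 / (n - n1)) *\<^sub>M (T (l2, m2, n) - T (l2, m2, n1)))]"

definition divided_difference ::
  "(triple \<Rightarrow> complex^'a^'a) \<Rightarrow> (triple \<Rightarrow> complex^'b^'b) \<Rightarrow> (triple \<Rightarrow> complex^'c^'c) \<Rightarrow>
   triple \<Rightarrow> triple \<Rightarrow> complex^('a \<times> 'b \<times> 'c)^('a \<times> 'b \<times> 'c)"
  where "divided_difference T1 T2 T3 p1 p2 =
    operator_det3 (diff_row T1 p1 p2) (diff_row T2 p1 p2) (diff_row T3 p1 p2)"

definition right_eigenvector ::
  "(triple \<Rightarrow> complex^'a^'a) \<Rightarrow> (triple \<Rightarrow> complex^'b^'b) \<Rightarrow> (triple \<Rightarrow> complex^'c^'c) \<Rightarrow>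
   triple \<Rightarrow> complex^'a \<Rightarrow> complex^'b \<Rightarrow> complex^'c \<Rightarrow> bool"
  where "right_eigenvector T1 T2 T3 p x1 x2 x3 \<longleftrightarrow>
    T1 p *v x1 = 0 \<and> x1 \<noteq> 0 \<and> T2 p *v x2 = 0 \<and> x2 \<noteq> 0 \<and> T3 p *v x3 = 0 \<and> x3 \<noteq> 0"

definition left_eigenvector ::
  "(triple \<Rightarrow> complex^'a^'a) \<Rightarrow> (triple \<Rightarrow> complex^'b^'b) \<Rightarrow> (triple \<Rightarrow> complex^'c^'c) \<Rightarrow>
   triple \<Rightarrow> complex^'a \<Rightarrow> complex^'b \<Rightarrow> complex^'c \<Rightarrow> bool"
  where "left_eigenvector T1 T2 T3 p y1 y2 y3 \<longleftrightarrow>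
    vconj y1 v* T1 p = 0 \<and> y1 \<noteq> 0 \<and> vconj y2 v* T2 p = 0 \<and> y2 \<noteq> 0 \<and>
    vconj y3 v* T3 p = 0 \<and> y3 \<noteq> 0"

definition eigenvalue ::
  "(triple \<Rightarrow> complex^'a^'a) \<Rightarrow> (triple \<Rightarrow> complex^'b^'b) \<Rightarrow> (triple \<Rightarrow> complex^'c^'c) \<Rightarrow>
   triple \<Rightarrow> bool"
  where "eigenvalue T1 T2 T3 p \<longleftrightarrow> (\<exists>x1 x2 x3. right_eigenvector T1 T2 T3 p x1 x2 x3)"

fun gradient3 :: "(triple \<Rightarrow> complex) \<Rightarrow> triple \<Rightarrow> complex^3"
  where "gradient3 f (l, m, n) = vector
    [deriv (\<lambda>z. f (z, m, n)) l, deriv (\<lambda>z. f (l, z, n)) m, deriv (\<lambda>z. f (l, m, z)) n]"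

definition jacobian3 ::
  "(triple \<Rightarrow> complex) \<Rightarrow> (triple \<Rightarrow> complex) \<Rightarrow> (triple \<Rightarrow> complex) \<Rightarrow> triple \<Rightarrow> complex^3^3"
  where "jacobian3 f1 f2 f3 p = vector [gradient3 f1 p, gradient3 f2 p, gradient3 f3 p]"

definition simple_common_zero ::
  "(triple \<Rightarrow> complex) \<Rightarrow> (triple \<Rightarrow> complex) \<Rightarrow> (triple \<Rightarrow> complex) \<Rightarrow> triple \<Rightarrow> bool"
  where "simple_common_zero f1 f2 f3 p \<longleftrightarrow>
    f1 p = 0 \<and> f2 p = 0 \<and> f3 p = 0 \<and> invertible (jacobian3 f1 f2 f3 p)"

definition simple_eigenvalue ::
  "(triple \<Rightarrow> complex^'a^'a) \<Rightarrow> (triple \<Rightarrow> complex^'b^'b) \<Rightarrow> (triple \<Rightarrow> complex^'c^'c) \<Rightarrow>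
   triple \<Rightarrow> bool"
  where "simple_eigenvalue T1 T2 T3 p \<longleftrightarrow>
    eigenvalue T1 T2 T3 p \<and>
    simple_common_zero (\<lambda>p. det (T1 p)) (\<lambda>p. det (T2 p)) (\<lambda>p. det (T3 p)) p"

end

theory Submission
  imports Defs
begin

text \<open>
  Pairing the operator determinant with decomposable vectors turns it into the ordinary
  determinant of the matrix $G$ with entries $G_{ij} = y_i^* M_{ij} x_i$. For different eigenvalues
  the divided differences telescope, so that $G$ annihilates the difference of the two triples.
  For equal ones the $M_{ij}$ are partial derivatives, and each row of the Jacobian of the
  $\det T_i$ is a multiple of the corresponding row of $G$, because at a singular matrix $A$ with
  $Ax = 0$ and $y^*A = 0$ the differential of $\det$ is a multiple of $H \mapsto y^*Hx$. Hence the
  Jacobian can only be nonsingular if $G$ is.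
\<close>

section \<open>The form \<open>sesq\<close> and Kronecker products\<close>

lemma mscale_nth [simp]: "(c *\<^sub>M A) $ i $ j = c * A $ i $ j"
  by (simp add: mscale_def map_matrix_def)

lemma sesq_altdef: "sesq y A x = (\<Sum>i\<in>UNIV. \<Sum>j\<in>UNIV. cnj (y $ i) * A $ i $ j * x $ j)"
  by (simp add: sesq_def vconj_def matrix_vector_mult_def sum_distrib_left mult.assoc)

lemma sesq_add: "sesq y (A + B) x = sesq y A x + sesq y B x"
  by (simp add: sesq_altdef ring_distribs sum.distrib)

lemma sesq_diff: "sesq y (A - B) x = sesq y A x - sesq y B x"
  by (simp add: sesq_altdef algebra_simps sum_subtractf)

lemma sesq_mscale: "sesq y (c *\<^sub>M A) x = c * sesq y A x"
  by (simp add: sesq_altdef sum_distrib_left mult_ac)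

lemma sesq_zero: "sesq y 0 x = 0"
  by (simp add: sesq_altdef)

lemma sesq_sum: "sesq y (\<Sum>s\<in>S. F s) x = (\<Sum>s\<in>S. sesq y (F s) x)"
  by (induction S rule: infinite_finite_induct) (simp_all add: sesq_zero sesq_add)

lemma sesq_eq_0_right: "A *v x = 0 \<Longrightarrow> sesq y A x = 0"
  by (simp add: sesq_def)

lemma sesq_eq_0_left:
  assumes "vconj y v* A = 0"
  shows "sesq y A x = 0"
proof -
  have "(\<Sum>i\<in>UNIV. cnj (y $ i) * A $ i $ j) = 0" for j
    using arg_cong[OF assms, of "\<lambda>v. v $ j"]
    by (simp add: vector_matrix_mult_def vconj_def mult.commute)
  moreover have "sesq y A x = (\<Sum>j\<in>UNIV. (\<Sum>i\<in>UNIV. cnj (y $ i) * A $ i $ j) * x $ j)"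
    unfolding sesq_altdef by (subst sum.swap) (simp add: sum_distrib_right)
  ultimately show ?thesis
    by simp
qed

lemma mkron_mult_vkron: "(A \<otimes>\<^sub>M B) *v (x \<otimes>\<^sub>v u) = (A *v x) \<otimes>\<^sub>v (B *v u)"
  by (simp add: vec_eq_iff matrix_vector_mult_def mkron_def vkron_def sum_product
      sum.cartesian_product flip: UNIV_Times_UNIV)
    (simp add: case_prod_beta mult_ac)

lemma vconj_vkron: "vconj (y \<otimes>\<^sub>v v) = vconj y \<otimes>\<^sub>v vconj v"
  by (simp add: vec_eq_iff vconj_def vkron_def)

lemma sesq_kron:
  "sesq (y \<otimes>\<^sub>v v) (A \<otimes>\<^sub>M B) (x \<otimes>\<^sub>v u) = sesq y A x * sesq v B u"
  unfolding sesq_def mkron_mult_vkron vconj_vkron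
  by (simp add: vkron_def sum_product sum.cartesian_product flip: UNIV_Times_UNIV)
    (simp add: case_prod_beta mult_ac)

text \<open>This is $G$ of the overview when the \<open>M\<close> arguments are rows of divided
  differences. The rows are separate arguments because their matrices may differ in size.\<close>

definition compression3 ::
  "complex^'a \<Rightarrow> complex^'b \<Rightarrow> complex^'c \<Rightarrow>
   (complex^'a^'a)^3 \<Rightarrow> (complex^'b^'b)^3 \<Rightarrow> (complex^'c^'c)^3 \<Rightarrow>
   complex^'a \<Rightarrow> complex^'b \<Rightarrow> complex^'c \<Rightarrow> complex^3^3"
  where "compression3 y1 y2 y3 M1 M2 M3 x1 x2 x3 = vector
    [\<chi> j. sesq y1 (M1 $ j) x1, \<chi> j. sesq y2 (M2 $ j) x2, \<chi> j. sesq y3 (M3 $ j) x3]"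

text \<open>By \<open>sesq_kron\<close> the form is multiplicative over Kronecker products, so the
  signed sum over permutations turns into the Leibniz expansion of a scalar determinant.\<close>

lemma sesq_operator_det3:
  "sesq (y1 \<otimes>\<^sub>v y2 \<otimes>\<^sub>v y3) (operator_det3 M1 M2 M3) (x1 \<otimes>\<^sub>v x2 \<otimes>\<^sub>v x3) =
   det (compression3 y1 y2 y3 M1 M2 M3 x1 x2 x3)"
proof -
  \<comment> \<open>The right nesting matches that of the Kronecker products.\<close>
  have "(\<Prod>i\<in>UNIV. f i) = f 1 * (f 2 * f 3)" for f :: "3 \<Rightarrow> complex"
    unfolding UNIV_3 by simp
  then show ?thesis
    unfolding operator_det3_def sesq_sum sesq_mscale sesq_kron det_def compression3_def
    by (simp only: vector_3 vec_lambda_beta mult.assoc)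
qed

section \<open>The derivative of the determinant at a singular matrix\<close>

text \<open>
  Replacing column $k$ of $A$ by $Ax$ and then row $r$ by $y^*A$ multiplies the determinant by
  $x_k \bar y_r$. At the singular matrix, row $r$ and column $k$ then vanish, so that only their
  common entry $y^*Ax$ contributes to the derivative.
\<close>

lemma det_singular_has_field_derivative:
  fixes A0 :: "complex^'n^'n"
  assumes Ax: "A0 *v x = 0" "x \<noteq> 0" and yA: "vconj y v* A0 = 0" "y \<noteq> 0"
  obtains c where "\<And>A A' z. A z = A0 \<Longrightarrow>
    (\<And>i j. ((\<lambda>t. A t $ i $ j) has_field_derivative A' $ i $ j) (at z)) \<Longrightarrow>
    ((\<lambda>t. det (A t)) has_field_derivative c * sesq y A' x) (at z)"
proof -
  obtain k where k: "x $ k \<noteq> 0"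
    using \<open>x \<noteq> 0\<close> by (auto simp: vec_eq_iff)
  obtain r where r: "vconj y $ r \<noteq> 0"
    using \<open>y \<noteq> 0\<close> by (auto simp: vec_eq_iff vconj_def)
  define w where "w = vconj y"
  define C where "C A = (\<chi> i j. if j = k then (A *v x) $ i else A $ i $ j)" for A :: "complex^'n^'n"
  define B where "B A = (\<chi> i. if i = r then (\<Sum>i\<in>UNIV. w $ i *s row i (C A)) else row i (C A))"
    for A :: "complex^'n^'n"
  \<comment> \<open>Each of the two Cramer lemmas contributes one factor, \<open>x $ k\<close> for
    the column and \<open>w $ r\<close> for the row; both are nonzero by the choice of
    \<open>k\<close> and \<open>r\<close>.\<close>
  have det_B: "det A = det (B A) / (w $ r * x $ k)" for A
    using k r unfolding B_def cramer_lemma_transpose C_def cramer_lemma w_def by simp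
  have B_row: "B A $ r $ j = (\<Sum>i\<in>UNIV. w $ i * C A $ i $ j)" for A j
    by (simp add: B_def row_def)
  have B_other: "B A $ i $ j = C A $ i $ j" if "i \<noteq> r" for A i j
    using that by (simp add: B_def row_def)
  have wAx: "(\<Sum>i\<in>UNIV. w $ i * C A $ i $ k) = sesq y A x" for A
    by (simp add: C_def w_def sesq_def)
  have B0_row: "B A0 $ r $ j = 0" for j
  proof (cases "j = k")
    case True
    then show ?thesis
      by (simp add: B_row wAx sesq_eq_0_right Ax)
  next
    case False
    then show ?thesis
      using arg_cong[OF yA(1), of "\<lambda>v. v $ j"]
      by (simp add: B_row C_def w_def vector_matrix_mult_def mult.commute)
  qed
  have B0_col: "B A0 $ i $ k = 0" if "i \<noteq> r" for i
    using that by (simp add: B_other C_def Ax)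
  \<comment> \<open>\<open>cof \<sigma>\<close> is the Leibniz product of \<open>B A0\<close> for
    \<sigma> without its factor from row \<open>r\<close>. The sum in \<open>c\<close> is the
    cofactor of \<open>B A0\<close> at position \<open>(r, k)\<close>; hence \<open>c\<close> is
    fixed before any curve \<open>A\<close> is chosen.\<close>
  define cof where "cof \<sigma> = (\<Prod>i\<in>UNIV - {r}. B A0 $ i $ \<sigma> i)" for \<sigma> :: "'n \<Rightarrow> 'n"
  define c where
    "c = (\<Sum>\<sigma> | \<sigma> permutes (UNIV :: 'n set). of_int (sign \<sigma>) * (if \<sigma> r = k then cof \<sigma> else 0)) / (w $ r * x $ k)"
  \<comment> \<open>If \<sigma> does not send \<open>r\<close> to \<open>k\<close>, another row uses
    column \<open>k\<close>, where \<open>B A0\<close> has a zero.\<close>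
  have cof_0: "cof \<sigma> = 0" if \<sigma>: "\<sigma> permutes UNIV" "\<sigma> r \<noteq> k" for \<sigma>
  proof -
    obtain i where "\<sigma> i = k"
      using permutes_surj[OF \<sigma>(1)] by (metis surjD)
    then have "i \<in> UNIV - {r}" "B A0 $ i $ \<sigma> i = 0"
      using \<sigma>(2) B0_col[of i] by auto
    then show ?thesis
      unfolding cof_def by (intro prod_zero) auto
  qed
  show ?thesis
  proof
    fix A A' z
    assume Az: "A z = A0"
      and der: "\<And>i j. ((\<lambda>t. A t $ i $ j) has_field_derivative A' $ i $ j) (at z)"
    \<comment> \<open>\<open>C\<close> and \<open>B\<close> are linear in the matrix, so they can be
      applied to the derivative \<open>A'\<close> itself.\<close>
    have derC: "((\<lambda>t. C (A t) $ i $ j) has_field_derivative C A' $ i $ j) (at z)" for i j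
      by (cases "j = k") (auto simp: C_def matrix_vector_mult_def intro!: derivative_eq_intros der)
    have derB: "((\<lambda>t. B (A t) $ i $ j) has_field_derivative B A' $ i $ j) (at z)" for i j
      by (cases "i = r") (auto simp: B_row B_other mult.commute intro!: derivative_eq_intros derC)
    \<comment> \<open>In the product rule, the terms that leave the factor from row \<open>r\<close>
      undifferentiated vanish by \<open>B0_row\<close>.\<close>
    have "((\<lambda>t. \<Prod>i\<in>UNIV. B (A t) $ i $ \<sigma> i) has_field_derivative B A' $ r $ \<sigma> r * cof \<sigma>) (at z)"
      for \<sigma>
    proof -
      have "((\<lambda>t. \<Prod>i\<in>UNIV - {r}. B (A t) $ i $ \<sigma> i) has_field_derivative
          (\<Sum>i\<in>UNIV - {r}. B A' $ i $ \<sigma> i * (\<Prod>j\<in>UNIV - {r} - {i}. B (A z) $ j $ \<sigma> j))) (at z)"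
        by (intro has_field_derivative_prod derB)
      from DERIV_mult[OF derB[of r "\<sigma> r"] this]
      show ?thesis
        by (simp add: prod.remove[of UNIV r] Az B0_row cof_def)
    qed
    then have "((\<lambda>t. det (B (A t)) / (w $ r * x $ k)) has_field_derivative
        (\<Sum>\<sigma> | \<sigma> permutes UNIV. of_int (sign \<sigma>) * (B A' $ r $ \<sigma> r * cof \<sigma>)) / (w $ r * x $ k)) (at z)"
      unfolding det_def by (intro DERIV_cdivide DERIV_sum DERIV_cmult)
    \<comment> \<open>Only permutations with \<open>\<sigma> r = k\<close> survive, and they share
      the factor \<open>B A' $ r $ k\<close>, which is \<open>sesq y A' x\<close>.\<close>
    moreover have "(\<Sum>\<sigma> | \<sigma> permutes UNIV. of_int (sign \<sigma>) * (B A' $ r $ \<sigma> r * cof \<sigma>)) =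
        (\<Sum>\<sigma> | \<sigma> permutes UNIV. of_int (sign \<sigma>) * (if \<sigma> r = k then cof \<sigma> else 0)) * B A' $ r $ k"
      unfolding sum_distrib_right by (intro sum.cong) (auto simp: cof_0)
    ultimately show "((\<lambda>t. det (A t)) has_field_derivative c * sesq y A' x) (at z)"
      by (simp add: det_B[symmetric] c_def B_row wAx)
  qed
qed

section \<open>Partial derivatives and divided differences\<close>

lemma analytic3_on_partials:
  assumes "analytic3_on T S" "(l, m, n) \<in> S"
  obtains D1 D2 D3 where
    "\<And>i j. ((\<lambda>z. T (z, m, n) $ i $ j) has_field_derivative D1 $ i $ j) (at l)"
    "\<And>i j. ((\<lambda>z. T (l, z, n) $ i $ j) has_field_derivative D2 $ i $ j) (at m)"
    "\<And>i j. ((\<lambda>z. T (l, m, z) $ i $ j) has_field_derivative D3 $ i $ j) (at n)"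
proof -
  obtain D1 D2 D3 where D:
    "(T has_derivative (\<lambda>(h, k, l). h *\<^sub>M D1 + k *\<^sub>M D2 + l *\<^sub>M D3)) (at (l, m, n))"
    using assms unfolding analytic3_on_def by blast
  \<comment> \<open>The chain rule along a curve \<open>g\<close> through the point, read entrywise;
    below, \<open>g\<close> runs along the three coordinate lines.\<close>
  have entry: "((\<lambda>z. T (g z) $ i $ j) has_derivative (\<lambda>h. case g' h of (h, k, l) \<Rightarrow>
      h * D1 $ i $ j + k * D2 $ i $ j + l * D3 $ i $ j)) (at z)"
    if "(g has_derivative g') (at z)" "g z = (l, m, n)" for g :: "complex \<Rightarrow> triple" and g' z i j
  proof -
    have "((\<lambda>z. T (g z)) has_derivative (\<lambda>h. (\<lambda>(h, k, l). h *\<^sub>M D1 + k *\<^sub>M D2 + l *\<^sub>M D3) (g' h))) (at z)"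
      using has_derivative_compose[OF that(1)] D that(2) by metis
    from bounded_linear.has_derivative[OF bounded_linear_vec_nth[of j]
        bounded_linear.has_derivative[OF bounded_linear_vec_nth[of i] this]]
    show ?thesis
      by (simp add: case_prod_beta)
  qed
  show ?thesis
  proof
    fix i j
    have "((\<lambda>z. (z, m, n)) has_derivative (\<lambda>h. (h, 0, 0))) (at l)"
      "((\<lambda>z. (l, z, n)) has_derivative (\<lambda>h. (0, h, 0))) (at m)"
      "((\<lambda>z. (l, m, z)) has_derivative (\<lambda>h. (0, 0, h))) (at n)"
      by (auto simp: zero_prod_def intro!: derivative_eq_intros)
    note entry[OF this(1) refl, of i j] entry[OF this(2) refl, of i j] entry[OF this(3) refl, of i j]
    then show "((\<lambda>z. T (z, m, n) $ i $ j) has_field_derivative D1 $ i $ j) (at l)"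
      "((\<lambda>z. T (l, z, n) $ i $ j) has_field_derivative D2 $ i $ j) (at m)"
      "((\<lambda>z. T (l, m, z) $ i $ j) has_field_derivative D3 $ i $ j) (at n)"
      by (simp_all add: has_field_derivative_def mult_commute_abs)
  qed
qed

lemma Lim_difference_quotient:
  fixes f :: "complex \<Rightarrow> complex^'n^'m"
  assumes "\<And>i j. ((\<lambda>z. f z $ i $ j) has_field_derivative D $ i $ j) (at a)"
  shows "Lim (at a) (\<lambda>z. (1 / (z - a)) *\<^sub>M (f z - f a)) = D"
  using assms by (intro tendsto_Lim vec_tendstoI) (auto simp: has_field_derivative_iff)

text \<open>The factor \<open>b - a\<close> gives both cases one formula: for \<open>b = a\<close>
  both sides vanish; otherwise the quotient is continuous at \<open>b\<close>, so the limit is its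
  value there.\<close>

lemma mscale_Lim_difference_quotient:
  fixes f :: "complex \<Rightarrow> complex^'n^'m"
  assumes "\<And>i j. ((\<lambda>z. f z $ i $ j) has_field_derivative D $ i $ j) (at b)"
  shows "(b - a) *\<^sub>M Lim (at b) (\<lambda>z. (1 / (z - a)) *\<^sub>M (f z - f a)) = f b - f a"
proof (cases "b = a")
  case True
  then show ?thesis
    by (simp add: vec_eq_iff)
next
  case False
  have "((\<lambda>z. f z $ i $ j) \<longlongrightarrow> f b $ i $ j) (at b)" for i j
    using DERIV_isCont[OF assms] by (simp add: isCont_def)
  then have cont: "(f \<longlongrightarrow> f b) (at b)"
    by (intro vec_tendstoI)
  have "Lim (at b) (\<lambda>z. (1 / (z - a)) *\<^sub>M (f z - f a)) = (1 / (b - a)) *\<^sub>M (f b - f a)"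
    using False by (intro tendsto_Lim vec_tendstoI) (auto intro!: tendsto_eq_intros cont)
  with False show ?thesis
    by (simp add: vec_eq_iff)
qed

text \<open>The entries of the row follow a path that changes one coordinate at a time. The product
  form of the domain keeps the two intermediate corners inside it.\<close>

lemma diff_row_telescope:
  assumes "analytic3_on T (\<Omega>1 \<times> \<Omega>2 \<times> \<Omega>3)"
    and "(l1, m1, n1) \<in> \<Omega>1 \<times> \<Omega>2 \<times> \<Omega>3" "(l2, m2, n2) \<in> \<Omega>1 \<times> \<Omega>2 \<times> \<Omega>3"
  defines "M \<equiv> diff_row T (l1, m1, n1) (l2, m2, n2)"
  shows "(l2 - l1) *\<^sub>M M $ 1 + (m2 - m1) *\<^sub>M M $ 2 + (n2 - n1) *\<^sub>M M $ 3 =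
    T (l2, m2, n2) - T (l1, m1, n1)"
proof -
  have mem: "(l2, m1, n1) \<in> \<Omega>1 \<times> \<Omega>2 \<times> \<Omega>3" "(l2, m2, n1) \<in> \<Omega>1 \<times> \<Omega>2 \<times> \<Omega>3"
    using assms(2,3) by auto
  have "(l2 - l1) *\<^sub>M M $ 1 = T (l2, m1, n1) - T (l1, m1, n1)"
    by (rule analytic3_on_partials[OF assms(1) mem(1)])
      (simp add: M_def, rule mscale_Lim_difference_quotient, assumption)
  moreover have "(m2 - m1) *\<^sub>M M $ 2 = T (l2, m2, n1) - T (l2, m1, n1)"
    by (rule analytic3_on_partials[OF assms(1) mem(2)])
      (simp add: M_def, rule mscale_Lim_difference_quotient, assumption)
  moreover have "(n2 - n1) *\<^sub>M M $ 3 = T (l2, m2, n2) - T (l2, m2, n1)"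
    by (rule analytic3_on_partials[OF assms(1) assms(3)])
      (simp add: M_def, rule mscale_Lim_difference_quotient, assumption)
  ultimately show ?thesis
    by simp
qed

text \<open>\<open>y\<close> annihilates the value of \<open>T\<close> at the first triple and
  \<open>x\<close> the value at the second, so the telescoped difference pairs to zero.\<close>

lemma sesq_diff_row_orthogonal:
  assumes "analytic3_on T (\<Omega>1 \<times> \<Omega>2 \<times> \<Omega>3)"
    and "(l1, m1, n1) \<in> \<Omega>1 \<times> \<Omega>2 \<times> \<Omega>3" "(l2, m2, n2) \<in> \<Omega>1 \<times> \<Omega>2 \<times> \<Omega>3"
    and "vconj y v* T (l1, m1, n1) = 0" "T (l2, m2, n2) *v x = 0"
  defines "M \<equiv> diff_row T (l1, m1, n1) (l2, m2, n2)"
  shows "sesq y (M $ 1) x * (l2 - l1) + sesq y (M $ 2) x * (m2 - m1) + sesq y (M $ 3) x * (n2 - n1) = 0"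
proof -
  have "sesq y ((l2 - l1) *\<^sub>M M $ 1 + (m2 - m1) *\<^sub>M M $ 2 + (n2 - n1) *\<^sub>M M $ 3) x = 0"
    unfolding M_def diff_row_telescope[OF assms(1-3)]
    using assms(4,5) by (simp add: sesq_diff sesq_eq_0_left sesq_eq_0_right)
  then show ?thesis
    by (simp add: sesq_add sesq_mscale mult.commute)
qed

text \<open>The constant of \<open>det_singular_has_field_derivative\<close> depends on
  \<open>T p\<close>, \<open>x\<close> and \<open>y\<close> but not on the direction, so one
  \<open>c\<close> serves all three partial derivatives.\<close>

lemma gradient3_det:
  assumes "analytic3_on T S" "p \<in> S"
    and "vconj y v* T p = 0" "y \<noteq> 0" "T p *v x = 0" "x \<noteq> 0"
  obtains c where "gradient3 (\<lambda>p. det (T p)) p = c *s (\<chi> j. sesq y (diff_row T p p $ j) x)"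
proof -
  obtain l m n where p: "p = (l, m, n)"
    by (cases p)
  obtain D1 D2 D3 where D:
    "\<And>i j. ((\<lambda>z. T (z, m, n) $ i $ j) has_field_derivative D1 $ i $ j) (at l)"
    "\<And>i j. ((\<lambda>z. T (l, z, n) $ i $ j) has_field_derivative D2 $ i $ j) (at m)"
    "\<And>i j. ((\<lambda>z. T (l, m, z) $ i $ j) has_field_derivative D3 $ i $ j) (at n)"
    using analytic3_on_partials[of T S l m n] assms(1,2) p by blast
  obtain c where c: "\<And>A A' z. A z = T p \<Longrightarrow>
    (\<And>i j. ((\<lambda>t. A t $ i $ j) has_field_derivative A' $ i $ j) (at z)) \<Longrightarrow>
    ((\<lambda>t. det (A t)) has_field_derivative c * sesq y A' x) (at z)"
    using det_singular_has_field_derivative[OF assms(5,6,3,4)] by blast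
  have M: "diff_row T p p = vector [D1, D2, D3]"
    by (simp add: p Lim_difference_quotient[OF D(1)] Lim_difference_quotient[OF D(2)]
        Lim_difference_quotient[OF D(3)])
  have gradient: "gradient3 (\<lambda>p. det (T p)) p =
      vector [c * sesq y D1 x, c * sesq y D2 x, c * sesq y D3 x]"
    using c[OF _ D(1)] c[OF _ D(2)] c[OF _ D(3)] by (simp add: p DERIV_imp_deriv)
  show thesis
  proof
    show "gradient3 (\<lambda>p. det (T p)) p = c *s (\<chi> j. sesq y (diff_row T p p $ j) x)"
      unfolding M gradient by (subst vec_eq_iff) (simp add: forall_3)
  qed
qed

theorem proposition7:
  fixes T1 :: "triple \<Rightarrow> complex^'a^'a"
    and T2 :: "triple \<Rightarrow> complex^'b^'b"
    and T3 :: "triple \<Rightarrow> complex^'c^'c"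
    and \<Omega>1 \<Omega>2 \<Omega>3 :: "complex set"
    and p1 p2 :: triple
    and x1 y1 :: "complex^'a" and x2 y2 :: "complex^'b" and x3 y3 :: "complex^'c"
    and q :: complex
  assumes "open \<Omega>1" "connected \<Omega>1" "open \<Omega>2" "connected \<Omega>2" "open \<Omega>3" "connected \<Omega>3"
    and "analytic3_on T1 (\<Omega>1 \<times> \<Omega>2 \<times> \<Omega>3)"
    and "analytic3_on T2 (\<Omega>1 \<times> \<Omega>2 \<times> \<Omega>3)"
    and "analytic3_on T3 (\<Omega>1 \<times> \<Omega>2 \<times> \<Omega>3)"
    and "p1 \<in> \<Omega>1 \<times> \<Omega>2 \<times> \<Omega>3" and "p2 \<in> \<Omega>1 \<times> \<Omega>2 \<times> \<Omega>3"
    and "eigenvalue T1 T2 T3 p1" and "left_eigenvector T1 T2 T3 p1 y1 y2 y3"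
    and "eigenvalue T1 T2 T3 p2" and "right_eigenvector T1 T2 T3 p2 x1 x2 x3"
    and "q = sesq (y1 \<otimes>\<^sub>v y2 \<otimes>\<^sub>v y3) (divided_difference T1 T2 T3 p1 p2) (x1 \<otimes>\<^sub>v x2 \<otimes>\<^sub>v x3)"
  shows "(p2 = p1 \<and> simple_eigenvalue T1 T2 T3 p1 \<longrightarrow> q \<noteq> 0) \<and>
         (p2 \<noteq> p1 \<longrightarrow> q = 0)"
proof (intro conjI impI)
  let ?G = "compression3 y1 y2 y3 (diff_row T1 p1 p2) (diff_row T2 p1 p2) (diff_row T3 p1 p2) x1 x2 x3"
  have q: "q = det ?G"
    using assms(16) by (simp add: divided_difference_def sesq_operator_det3)
  have L: "vconj y1 v* T1 p1 = 0" "y1 \<noteq> 0" "vconj y2 v* T2 p1 = 0" "y2 \<noteq> 0"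
    "vconj y3 v* T3 p1 = 0" "y3 \<noteq> 0"
    using assms(13) by (auto simp: left_eigenvector_def)
  have R: "T1 p2 *v x1 = 0" "x1 \<noteq> 0" "T2 p2 *v x2 = 0" "x2 \<noteq> 0" "T3 p2 *v x3 = 0" "x3 \<noteq> 0"
    using assms(15) by (auto simp: right_eigenvector_def)
  {
    assume *: "p2 = p1 \<and> simple_eigenvalue T1 T2 T3 p1"
    let ?J = "jacobian3 (\<lambda>p. det (T1 p)) (\<lambda>p. det (T2 p)) (\<lambda>p. det (T3 p)) p1"
    obtain c1 where c1: "gradient3 (\<lambda>p. det (T1 p)) p1 = c1 *s (\<chi> j. sesq y1 (diff_row T1 p1 p1 $ j) x1)"
      using gradient3_det[OF assms(7,10) L(1,2)] R * by metis
    obtain c2 where c2: "gradient3 (\<lambda>p. det (T2 p)) p1 = c2 *s (\<chi> j. sesq y2 (diff_row T2 p1 p1 $ j) x2)"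
      using gradient3_det[OF assms(8,10) L(3,4)] R * by metis
    obtain c3 where c3: "gradient3 (\<lambda>p. det (T3 p)) p1 = c3 *s (\<chi> j. sesq y3 (diff_row T3 p1 p1 $ j) x3)"
      using gradient3_det[OF assms(9,10) L(5,6)] R * by metis
    \<comment> \<open>Row by row, the Jacobian is \<open>?G\<close> scaled by \<open>c1\<close>,
      \<open>c2\<close> and \<open>c3\<close>.\<close>
    have "det ?J = c1 * c2 * c3 * det ?G"
      using * by (simp add: jacobian3_def c1 c2 c3 compression3_def det_3 algebra_simps)
    moreover have "det ?J \<noteq> 0"
      using * by (simp add: simple_eigenvalue_def simple_common_zero_def invertible_det_nz)
    ultimately show "q \<noteq> 0"
      by (auto simp: q)
  next
    assume "p2 \<noteq> p1"
    obtain l1 m1 n1 l2 m2 n2 where p: "p1 = (l1, m1, n1)" "p2 = (l2, m2, n2)"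
      by (cases p1, cases p2)
    define d :: "complex^3" where "d = vector [l2 - l1, m2 - m1, n2 - n1]"
    \<comment> \<open>Each orthogonality relation is one component of this equation;
      \<open>diff_row\<close> stays folded so that the relations match.\<close>
    have "?G *v d = 0"
      using sesq_diff_row_orthogonal[OF assms(7) assms(10,11)[unfolded p] L(1)[unfolded p] R(1)[unfolded p]]
        sesq_diff_row_orthogonal[OF assms(8) assms(10,11)[unfolded p] L(3)[unfolded p] R(3)[unfolded p]]
        sesq_diff_row_orthogonal[OF assms(9) assms(10,11)[unfolded p] L(5)[unfolded p] R(5)[unfolded p]]
      by (simp add: vec_eq_iff forall_3 matrix_vector_mult_def sum_3 compression3_def d_def p
          del: diff_row.simps)
    moreover have "d \<noteq> 0"
      using \<open>p2 \<noteq> p1\<close> by (auto simp: d_def p vec_eq_iff forall_3)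
    ultimately have "\<not> invertible ?G"
      using matrix_left_invertible_ker[of ?G] by (auto simp: invertible_def)
    then show "q = 0"
      by (simp add: q invertible_det_nz)
  }
qed

end
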